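(* Let $p$ be an odd prime, $\lambda\in\mathbb{C}_p$ with $\lambda\neq0$, and $x\in\mathbb{C}_p$. For every integer $n\ge0$, \[ B_{n,\lambda}(x)=\int_{\mathbb{Z}_p}\left(x+y+\tfrac12\right)_{n,\lambda}d\mu_1(y)=\sum_{l=0}^{n}S_{1,\lambda}(n,l)\,b_l(x)=\sum_{m=0}^{n}\binom{n}{m}B_{m,\lambda}\,(x)_{n-m,\lambda}. \]
   Context: For a uniformly differentiable $f$ on $\mathbb{Z}_p$, $\int_{\mathbb{Z}_p}f(y)\,d\mu_1(y)=\lim_{N\to\infty}p^{-N}\sum_{y=0}^{p^N-1}f(y)$ (bosonic $p$-adic integral). Generalized falling factorial: $(x)_{0,\lambda}=1$, $(x)_{k,\lambda}=x(x-\lambda)\cdots(x-(k-1)\lambda)$ for $k\ge1$; degenerate exponential $e_\lambda^x(t)=(1+\lambda t)^{x/\lambda}=\sum_{k\ge0}(x)_{k,\lambda}\frac{t^k}{k!}$. Degenerate Stirling numbers of the first kind: $(x)_{n,\lambda}=\sum_{l=0}^nS_{1,\lambda}(n,l)x^l$. Type 2 Bernoulli polynomials: $\frac{t}{e^{t/2}-e^{-t/2}}e^{xt}=\sum_{n\ge0}b_n(x)\frac{t^n}{n!}$. Fully degenerate type 2 Bernoulli polynomials: $\frac{1}{\lambda}\,\frac{\log(1+\lambda t)}{e_\lambda^{1/2}(t)-e_\lambda^{-1/2}(t)}\,e_\lambda^x(t)=\sum_{n\ge0}B_{n,\lambda}(x)\frac{t^n}{n!}$, and $B_{n,\lambda}=B_{n,\lambda}(0)$.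 Generating functions are understood as formal power series in $t$. *)

theory Defs
  imports "HOL-Analysis.Analysis"
begin

section \<open>The field of complex p-adic numbers\<close>

text \<open>
  The libraries contain no $p$-adic numbers. A field type of characteristic 0 with a complete
  metric coming from an absolute value is said to be $C_p$ if it is the completion of an
  algebraic closure of $Q_p$; this determines it up to isometric isomorphism.
  The absolute value \<open>padic_abs\<close> is normalized by $|p| = 1/p$; it is not called
  \<open>norm\<close> because the library reserves that constant for real vector spaces. Since the ambient type is
  complete, $Q_p$ is the topological closure of the rational numbers in it.
\<close>

definition padic_abs :: "'a::{field_char_0, complete_space} \<Rightarrow> real" where
  "padic_abs x = dist x 0"

definition padic_Q :: "'a::{field_char_0, complete_space} set" where
  "padic_Q = closure \<rat>"

definition padic_Z :: "'a::{field_char_0, complete_space} set" where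
  "padic_Z = {x \<in> padic_Q. padic_abs x \<le> 1}"

definition padic_alg :: "'a::{field_char_0, complete_space} set" where
  "padic_alg = {x. \<exists>f. f \<noteq> 0 \<and> (\<forall>i. coeff f i \<in> padic_Q) \<and> poly f x = 0}"

text \<open>The condition on polynomials says that the field of elements algebraic over $Q_p$ is
  algebraically closed, i.e. that it is an algebraic closure of $Q_p$.\<close>

definition padic_complex :: "nat \<Rightarrow> 'a::{field_char_0, complete_space} itself \<Rightarrow> bool" where
  "padic_complex p (_ :: 'a itself) \<longleftrightarrow>
     prime p \<and>
     (\<forall>x y :: 'a. dist x y = padic_abs (x - y)) \<and>
     (\<forall>x y :: 'a. padic_abs (x * y) = padic_abs x * padic_abs y) \<and>
     (\<forall>x y :: 'a. padic_abs (x + y) \<le> max (padic_abs x) (padic_abs y)) \<and>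
     padic_abs (of_nat p :: 'a) = 1 / real p \<and>
     (\<forall>f :: 'a poly. degree f > 0 \<and> (\<forall>i. coeff f i \<in> padic_alg) \<longrightarrow>
        (\<exists>z\<in>padic_alg. poly f z = 0)) \<and>
     closure (padic_alg :: 'a set) = UNIV"

section \<open>The bosonic integral\<close>

definition uniformly_differentiable_on ::
    "('a::{field_char_0, complete_space} \<Rightarrow> 'a) \<Rightarrow> 'a set \<Rightarrow> bool" where
  "uniformly_differentiable_on f S \<longleftrightarrow>
     (\<exists>f'. \<forall>\<epsilon>>0. \<exists>\<delta>>0. \<forall>x\<in>S. \<forall>y\<in>S. x \<noteq> y \<and> dist x y < \<delta> \<longrightarrow>
        dist ((f x - f y) / (x - y)) (f' x) < \<epsilon>)"

text \<open>Existence of the integral comprises membership of the integrand in its domain, the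
  uniformly differentiable functions on $Z_p$, and convergence of the defining limit.\<close>

definition has_bosonic_integral ::
    "nat \<Rightarrow> ('a::{field_char_0, complete_space} \<Rightarrow> 'a) \<Rightarrow> 'a \<Rightarrow> bool" where
  "has_bosonic_integral p f I \<longleftrightarrow>
     uniformly_differentiable_on f padic_Z \<and>
     (\<lambda>N. (\<Sum>y<p ^ N. f (of_nat y)) / of_nat p ^ N) \<longlonglongrightarrow> I"

section \<open>Falling factorials, Stirling numbers, Bernoulli polynomials\<close>

definition gen_ffact :: "'a::comm_ring_1 \<Rightarrow> nat \<Rightarrow> 'a \<Rightarrow> 'a" where
  "gen_ffact x k lam = (\<Prod>i<k. x - of_nat i * lam)"

text \<open>The falling factorial is formed in the polynomial ring, with the monomial \<open>[:0, 1:]\<close>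
  in place of $x$; its coefficients are the Stirling numbers.\<close>

definition degenerate_stirling1 :: "'a::comm_ring_1 \<Rightarrow> nat \<Rightarrow> nat \<Rightarrow> 'a" where
  "degenerate_stirling1 lam n l = coeff (gen_ffact [:0, 1:] n [:lam:]) l"

lemma gen_ffact_eq_sum_stirling1:
  "gen_ffact x n lam = (\<Sum>l\<le>n. degenerate_stirling1 lam n l * x ^ l)"
proof -
  let ?P = "gen_ffact [:0, 1:] n [:lam:]"
  have factor: "[:0, 1:] - of_nat i * [:lam:] = [:- (of_nat i * lam), 1:]" for i
    by (simp add: of_nat_poly)
  have P: "?P = (\<Prod>i<n. [:- (of_nat i * lam), 1:])"
    unfolding gen_ffact_def factor ..
  have "degree ?P \<le> (\<Sum>i<n. degree [:- (of_nat i * lam), 1:])"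
    unfolding P by (rule degree_prod_sum_le[unfolded o_def]) simp
  hence deg: "degree ?P \<le> n" by simp
  have "gen_ffact x n lam = poly ?P x"
    unfolding P by (simp add: gen_ffact_def poly_prod)
  also have "\<dots> = (\<Sum>l\<le>n. coeff ?P l * x ^ l)"
    unfolding poly_altdef using deg
    by (intro sum.mono_neutral_left) (auto simp: coeff_eq_0)
  finally show ?thesis by (simp add: degenerate_stirling1_def)
qed

definition degenerate_exp :: "'a::field_char_0 \<Rightarrow> 'a \<Rightarrow> 'a fps" where
  "degenerate_exp lam x = Abs_fps (\<lambda>k. gen_ffact x k lam / fact k)"

text \<open>This is \<open>(1 + lam t)^(x/lam)\<close> as a formal binomial series.\<close>

lemma degenerate_exp_eq_binomial:
  fixes x :: "'a::field_char_0"
  assumes "lam \<noteq> 0"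
  shows "degenerate_exp lam x = fps_binomial (x / lam) oo (fps_const lam * fps_X)"
proof (rule fps_ext)
  fix k
  have "gen_ffact x k lam = (\<Prod>i<k. lam * (x / lam - of_nat i))"
    unfolding gen_ffact_def using assms by (intro prod.cong) (auto simp: field_simps)
  also have "\<dots> = lam ^ k * (\<Prod>i<k. x / lam - of_nat i)"
    by (simp add: prod.distrib)
  finally show "fps_nth (degenerate_exp lam x) k =
      fps_nth (fps_binomial (x / lam) oo (fps_const lam * fps_X)) k"
    by (simp add: degenerate_exp_def fps_compose_linear gbinomial_prod_rev atLeast0LessThan)
qed

text \<open>In the next two quotients of power series, numerator and denominator both have order 1.\<close>

definition bernoulli_type2 :: "nat \<Rightarrow> 'a::field_char_0 \<Rightarrow> 'a" where
  "bernoulli_type2 n x =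
     fact n * fps_nth (fps_X / (fps_exp (1/2) - fps_exp (-1/2)) * fps_exp x) n"

text \<open>\<open>fps_ln 1\<close> is the series of $\log(1 + t)$.\<close>

definition degenerate_bernoulli_type2 :: "'a::field_char_0 \<Rightarrow> nat \<Rightarrow> 'a \<Rightarrow> 'a" where
  "degenerate_bernoulli_type2 lam n x =
     fact n * fps_nth
       (fps_const (1 / lam) *
        ((fps_ln 1 oo (fps_const lam * fps_X)) /
         (degenerate_exp lam (1/2) - degenerate_exp lam (-1/2))) *
        degenerate_exp lam x) n"

end

theory Submission
  imports Defs
begin

text \<open>
  Write $e^a$ for the degenerate exponential $e_\lambda^a(t)$. Summing
  $e^{x+y+1/2} (e^{1/2} - e^{-1/2}) = e^{x+y+1} - e^{x+y}$ over $y < M$ telescopes to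
  $e^x (e^M - 1)$. The coefficients of $(e^M - 1)/M$ are polynomials in $M$, and at $M = 0$ they are
  those of $\log(1 + \lambda t)/\lambda$. So the mean of $(x+y+1/2)_{n,\lambda}$ over $y < M$ is a
  polynomial in $M$ with value $B_{n,\lambda}(x)$ at $0$, and the integral formula follows
  from $p^N \to 0$ and the continuity of polynomials. All of this makes sense for $\lambda = 0$, where
  it produces $b_n(x)$; the Stirling formula holds for the means at every positive integer $M$,
  hence for the polynomials, hence at $M = 0$.
\<close>

section \<open>The degenerate exponential\<close>

lemma degenerate_exp_nth: "fps_nth (degenerate_exp lam x) k = gen_ffact x k lam / fact k"
  by (simp add: degenerate_exp_def)

lemma gen_ffact_lam_0 [simp]: "gen_ffact x k 0 = x ^ k"
  by (simp add: gen_ffact_def)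

lemma degenerate_exp_lam_0: "degenerate_exp 0 x = fps_exp x"
  by (rule fps_ext) (simp add: degenerate_exp_nth)

text \<open>Vandermonde convolution, inherited from the binomial series. That form divides by
  \<open>lam\<close>, so the ordinary exponential is a case of its own.\<close>

lemma degenerate_exp_add:
  fixes x y :: "'a::field_char_0"
  shows "degenerate_exp lam (x + y) = degenerate_exp lam x * degenerate_exp lam y"
proof (cases "lam = 0")
  case True
  then show ?thesis by (simp add: degenerate_exp_lam_0 fps_exp_add_mult)
next
  case False
  then show ?thesis
    by (simp add: degenerate_exp_eq_binomial add_divide_distrib fps_binomial_add_mult
        fps_compose_mult_distrib)
qed

text \<open>The cofactor of $M$ in the falling factorial of length \<open>Suc j\<close>, kept as a
  polynomial in $M$ so that it can be evaluated at $M = 0$.\<close>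

definition gen_ffact_quot :: "'a::comm_ring_1 \<Rightarrow> nat \<Rightarrow> 'a poly" where
  "gen_ffact_quot lam j = (\<Prod>i<j. [:- (of_nat (Suc i) * lam), 1:])"

lemma gen_ffact_Suc_eq: "gen_ffact M (Suc j) lam = M * poly (gen_ffact_quot lam j) M"
  unfolding gen_ffact_def gen_ffact_quot_def prod.lessThan_Suc_shift
  by (simp add: poly_prod algebra_simps)

lemma degenerate_exp_0 [simp]: "degenerate_exp lam (0 :: 'a::field_char_0) = 1"
proof (rule fps_ext)
  fix k
  show "fps_nth (degenerate_exp lam (0 :: 'a)) k = fps_nth 1 k"
    by (cases k) (simp_all add: degenerate_exp_nth gen_ffact_Suc_eq, simp add: gen_ffact_def)
qed

lemma poly_gen_ffact_quot_0: "poly (gen_ffact_quot lam j) 0 = (- lam) ^ j * fact j"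
  unfolding gen_ffact_quot_def
  by (induction j) (simp_all add: poly_prod algebra_simps)

text \<open>The series $(e^M - 1)/(M t)$, given by coefficients so that it also has a value at $M =
  0$.\<close>

definition degenerate_exp_quot :: "'a::field_char_0 \<Rightarrow> 'a \<Rightarrow> 'a fps" where
  "degenerate_exp_quot lam M = Abs_fps (\<lambda>j. poly (gen_ffact_quot lam j) M / fact (Suc j))"

lemma degenerate_exp_minus_1:
  "degenerate_exp lam M - 1 = fps_const M * (fps_X * degenerate_exp_quot lam M)"
proof (rule fps_ext)
  fix k
  show "fps_nth (degenerate_exp lam M - 1) k
      = fps_nth (fps_const M * (fps_X * degenerate_exp_quot lam M)) k"
    by (cases k)
       (simp_all add: degenerate_exp_nth degenerate_exp_quot_def gen_ffact_Suc_eq,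
        simp add: gen_ffact_def)
qed

lemma degenerate_exp_quot_0_lam_0: "degenerate_exp_quot 0 0 = 1"
proof (rule fps_ext)
  fix k
  show "fps_nth (degenerate_exp_quot 0 0) k = fps_nth (1 :: 'a fps) k"
    by (cases k) (simp_all add: degenerate_exp_quot_def poly_gen_ffact_quot_0)
qed

text \<open>At $M = 0$ the coefficient of $t^j$ is
  \<open>(- lam) ^ j * fact j / fact (Suc j)\<close>, that is
  \<open>(- lam) ^ j / of_nat (Suc j)\<close>: the Mercator series.\<close>

lemma degenerate_exp_quot_0:
  assumes "lam \<noteq> 0"
  shows "fps_X * degenerate_exp_quot lam 0
    = fps_const (1 / lam) * (fps_ln 1 oo (fps_const lam * fps_X))"
proof (rule fps_ext)
  fix k
  show "fps_nth (fps_X * degenerate_exp_quot lam 0) k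
      = fps_nth (fps_const (1 / lam) * (fps_ln 1 oo (fps_const lam * fps_X))) k"
  proof (cases k)
    case (Suc j)
    have "(- lam) ^ j = (- 1) ^ j * lam ^ j"
      by (metis mult_minus1 power_mult_distrib)
    moreover have "fps_nth (fps_X * degenerate_exp_quot lam 0) k = (- lam) ^ j / of_nat (Suc j)"
      using Suc by (simp add: degenerate_exp_quot_def poly_gen_ffact_quot_0 del: of_nat_Suc)
    ultimately show ?thesis
      using assms Suc by (simp add: fps_compose_linear fps_ln_def del: of_nat_Suc)
  qed (simp add: fps_compose_linear fps_ln_def)
qed

section \<open>Division by $e^{1/2} - e^{-1/2}$\<close>

text \<open>The denominator of the generating function with its factor $t$ removed. The constant
  term is 1, so the series is a unit; for \<open>lam = 0\<close> it is $2 sinh(t/2)/t$.\<close>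

definition sinh_quot :: "'a::field_char_0 \<Rightarrow> 'a fps" where
  "sinh_quot lam = fps_shift 1 (degenerate_exp lam (1/2) - degenerate_exp lam (-1/2))"

lemma degenerate_sinh_eq:
  "degenerate_exp lam (1/2) - degenerate_exp lam (-1/2) = fps_X * sinh_quot lam"
proof (rule fps_ext)
  fix k
  show "fps_nth (degenerate_exp lam (1/2) - degenerate_exp lam (-1/2)) k
      = fps_nth (fps_X * sinh_quot lam) k"
    by (cases k) (simp_all add: sinh_quot_def degenerate_exp_nth gen_ffact_def)
qed

lemma sinh_quot_nth_0: "fps_nth (sinh_quot lam) 0 = 1"
  by (simp add: sinh_quot_def degenerate_exp_nth gen_ffact_def field_simps)

lemma divide_degenerate_sinh:
  "fps_X * f / (degenerate_exp lam (1/2) - degenerate_exp lam (-1/2)) = f * inverse (sinh_quot lam)"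
proof -
  have "fps_X * f / (fps_X * sinh_quot lam) = f / sinh_quot lam"
    by (rule div_mult_mult1) simp
  then show ?thesis
    unfolding degenerate_sinh_eq by (simp add: fps_divide_unit sinh_quot_nth_0)
qed

section \<open>The mean polynomial\<close>

text \<open>The $n$-th coefficient of the product in \<open>poly_mean_poly\<close>, with the
  convolution written out: of its factors only \<open>degenerate_exp_quot\<close> depends on
  $M$.\<close>

definition mean_poly :: "'a::field_char_0 \<Rightarrow> nat \<Rightarrow> 'a \<Rightarrow> 'a poly" where
  "mean_poly lam n x = (\<Sum>j\<le>n. smult
     (fact n * fps_nth (inverse (sinh_quot lam) * degenerate_exp lam x) (n - j) / fact (Suc j))
     (gen_ffact_quot lam j))"

lemma poly_mean_poly:
  "poly (mean_poly lam n x) M = fact n *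
     fps_nth (degenerate_exp_quot lam M * inverse (sinh_quot lam) * degenerate_exp lam x) n"
  unfolding mult.assoc fps_mult_nth[of "degenerate_exp_quot lam M"]
  by (simp add: mean_poly_def poly_sum sum_distrib_left degenerate_exp_quot_def atLeast0AtMost
      algebra_simps del: fact_Suc)

text \<open>The telescoping sum, read off at $t^n$. With the factor $M$ on the right instead of a
  division, $M = 0$ is included.\<close>

lemma sum_gen_ffact_eq_mean_poly:
  "(\<Sum>y<M. gen_ffact (x + of_nat y + 1/2) n lam) = of_nat M * poly (mean_poly lam n x) (of_nat M)"
proof -
  let ?E = "degenerate_exp lam" and ?U = "sinh_quot lam"
  let ?S = "\<Sum>y<M. ?E (x + of_nat y + 1/2)"
  have "fps_X * ?U * ?S = (\<Sum>y<M. ?E (x + of_nat (Suc y)) - ?E (x + of_nat y))"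
    unfolding sum_distrib_left
  proof (rule sum.cong[OF refl])
    fix y
    have "?E (x + of_nat y + 1/2) * ?E (1/2) = ?E (x + of_nat (Suc y))"
         "?E (x + of_nat y + 1/2) * ?E (-1/2) = ?E (x + of_nat y)"
      by (simp_all flip: degenerate_exp_add add: algebra_simps)
    then show "fps_X * ?U * ?E (x + of_nat y + 1/2) = ?E (x + of_nat (Suc y)) - ?E (x + of_nat y)"
      by (simp flip: degenerate_sinh_eq add: algebra_simps)
  qed
  also have "\<dots> = ?E (x + of_nat M) - ?E (x + of_nat 0)"
    by (rule sum_lessThan_telescope)
  also have "\<dots> = ?E x * (?E (of_nat M) - 1)"
    by (simp add: degenerate_exp_add algebra_simps)
  also have "\<dots> = fps_X * (fps_const (of_nat M) * degenerate_exp_quot lam (of_nat M) * ?E x)"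
    by (simp add: degenerate_exp_minus_1 algebra_simps)
  \<comment> \<open>The common factor $t$ cancels because power series over a field form an integral
    domain.\<close>
  finally have "?U * ?S = fps_const (of_nat M) * degenerate_exp_quot lam (of_nat M) * ?E x"
    by (simp add: mult.assoc)
  then have "inverse ?U * (?U * ?S)
      = fps_const (of_nat M) * (degenerate_exp_quot lam (of_nat M) * inverse ?U * ?E x)"
    by (simp add: algebra_simps)
  moreover have "inverse ?U * ?U = 1"
    by (rule inverse_mult_eq_1) (simp add: sinh_quot_nth_0)
  ultimately have S: "?S
      = fps_const (of_nat M) * (degenerate_exp_quot lam (of_nat M) * inverse ?U * ?E x)"
    by (simp flip: mult.assoc)
  have "(\<Sum>y<M. gen_ffact (x + of_nat y + 1/2) n lam) = fact n * fps_nth ?S n"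
    by (simp add: fps_sum_nth degenerate_exp_nth sum_distrib_left)
  then show ?thesis
    unfolding S fps_mult_left_const_nth poly_mean_poly by (simp only: mult.left_commute)
qed

section \<open>Values at $M = 0$ and the two finite expansions\<close>

lemma degenerate_bernoulli_eq_mean_poly:
  assumes "lam \<noteq> 0"
  shows "degenerate_bernoulli_type2 lam n x = poly (mean_poly lam n x) 0"
proof -
  let ?L = "fps_ln 1 oo (fps_const lam * fps_X)"
  \<comment> \<open>The logarithm is exhibited as a multiple of $t$, so that the quotient of two
    series of order 1 reduces to multiplication by the inverse of a unit.\<close>
  have "?L = fps_const lam * (fps_const (1 / lam) * ?L)"
    using assms by (simp flip: mult.assoc)
  then have L: "?L = fps_X * (fps_const lam * degenerate_exp_quot lam 0)"
    by (simp only: mult.left_commute flip: degenerate_exp_quot_0[OF assms])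
  show ?thesis
    unfolding degenerate_bernoulli_type2_def L divide_degenerate_sinh poly_mean_poly
    using assms by (simp flip: mult.assoc)
qed

text \<open>For \<open>lam = 0\<close> the numerator is $t$ itself, which matches
  \<open>degenerate_exp_quot 0 0 = 1\<close>.\<close>

lemma bernoulli_type2_eq_mean_poly: "bernoulli_type2 n x = poly (mean_poly 0 n x) 0"
proof -
  have "fps_X / (fps_exp (1/2) - fps_exp (-1/2)) = inverse (sinh_quot (0 :: 'a))"
    using divide_degenerate_sinh[of 1 0] by (simp add: degenerate_exp_lam_0)
  then show ?thesis
    by (simp add: bernoulli_type2_def poly_mean_poly degenerate_exp_quot_0_lam_0
        degenerate_exp_lam_0)
qed

lemma mean_poly_eq_sum_stirling1:
  "mean_poly lam n x = (\<Sum>l\<le>n. smult (degenerate_stirling1 lam n l) (mean_poly 0 l x))"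
  (is "?P = ?Q")
proof (rule ccontr)
  assume "?P \<noteq> ?Q"
  then have "finite {z. poly (?P - ?Q) z = 0}"
    by (intro poly_roots_finite) simp
  \<comment> \<open>Starting at 1 keeps the sample points nonzero, so the factor $M$ can be
    cancelled.\<close>
  moreover have "range (\<lambda>M. of_nat (Suc M)) \<subseteq> {z. poly (?P - ?Q) z = 0}"
  proof (clarify)
    fix k
    define M where "M = Suc k"
    have "of_nat M * poly ?P (of_nat M) = (\<Sum>y<M. gen_ffact (x + of_nat y + 1/2) n lam)"
      by (rule sum_gen_ffact_eq_mean_poly[symmetric])
    \<comment> \<open>Expanding in powers of $x + y + 1/2$ leaves power sums, which are the case
      \<open>lam = 0\<close> of the mean formula.\<close>
    also have "\<dots> = (\<Sum>l\<le>n. degenerate_stirling1 lam n l * (\<Sum>y<M. (x + of_nat y + 1/2) ^ l))"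
      unfolding gen_ffact_eq_sum_stirling1 sum_distrib_left by (rule sum.swap)
    also have "\<dots> = of_nat M * poly ?Q (of_nat M)"
      using sum_gen_ffact_eq_mean_poly[of x _ 0 M]
      by (simp add: poly_sum sum_distrib_left mult.left_commute)
    finally show "poly (?P - ?Q) (of_nat (Suc k)) = 0"
      unfolding M_def[symmetric] by (simp add: M_def del: of_nat_Suc)
  qed
  ultimately have "finite (range (\<lambda>M. of_nat (Suc M) :: 'a))"
    by (rule finite_subset[rotated])
  moreover have "inj (\<lambda>M. of_nat (Suc M) :: 'a)"
    by (intro injI) (simp del: of_nat_Suc)
  ultimately show False
    using finite_imageD by blast
qed

text \<open>The generating function is the one at argument 0 times $e^x$; compare
  coefficients.\<close>

lemma degenerate_bernoulli_eq_sum_binomial: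
  fixes x :: "'a::field_char_0"
  shows "degenerate_bernoulli_type2 lam n x =
    (\<Sum>m=0..n. of_nat (n choose m) * degenerate_bernoulli_type2 lam m 0 * gen_ffact x (n - m) lam)"
  unfolding degenerate_bernoulli_type2_def fps_mult_nth[of _ "degenerate_exp lam x"] sum_distrib_left
  by (intro sum.cong refl) (simp add: degenerate_exp_nth binomial_fact field_simps)

section \<open>Polynomials over a field with absolute value\<close>

locale abs_valued_field =
  fixes T :: "'a::{field_char_0, complete_space} itself"
  assumes dist_eq: "dist x y = padic_abs (x - y :: 'a)"
    and abs_mult: "padic_abs (x * y :: 'a) = padic_abs x * padic_abs y"
    and abs_add_le: "padic_abs (x + y :: 'a) \<le> padic_abs x + padic_abs y"
begin

lemma abs_nonneg [simp]: "padic_abs (x :: 'a) \<ge> 0"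
  by (simp add: padic_abs_def)

lemma abs_0 [simp]: "padic_abs (0 :: 'a) = 0"
  by (simp add: padic_abs_def)

lemma abs_pos: "x \<noteq> 0 \<Longrightarrow> padic_abs (x :: 'a) > 0"
  by (simp add: padic_abs_def)

lemma abs_1 [simp]: "padic_abs (1 :: 'a) = 1"
  using abs_mult[of 1 1] abs_pos[of 1] by simp

lemma abs_power: "padic_abs (x ^ k :: 'a) = padic_abs x ^ k"
  by (induction k) (simp_all add: abs_mult)

lemma abs_minus_commute: "padic_abs (x - y :: 'a) = padic_abs (y - x)"
  by (metis dist_eq dist_commute)

lemma poly_bounded_unit_ball:
  fixes f :: "'a poly"
  shows "\<exists>B\<ge>0. \<forall>x. padic_abs x \<le> 1 \<longrightarrow> padic_abs (poly f x) \<le> B"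
proof (induction f)
  case 0
  show ?case by auto
next
  case (pCons a f)
  then obtain B where B: "B \<ge> 0" "\<And>x. padic_abs x \<le> 1 \<Longrightarrow> padic_abs (poly f x) \<le> B"
    by auto
  have "padic_abs (poly (pCons a f) x) \<le> padic_abs a + B" if "padic_abs x \<le> 1" for x
  proof -
    have "padic_abs x * padic_abs (poly f x) \<le> 1 * B"
      using that B by (intro mult_mono) auto
    then show ?thesis
      using abs_add_le[of a "x * poly f x"] by (simp add: abs_mult)
  qed
  then show ?case using B(1) by (intro exI[of _ "padic_abs a + B"]) simp
qed

text \<open>First-order Taylor expansion with a quadratic remainder, uniform on the unit ball, by
  induction along Horner's scheme.\<close>

lemma poly_taylor_bound:
  fixes f :: "'a poly"
  shows "\<exists>C\<ge>0. \<forall>x y. padic_abs x \<le> 1 \<longrightarrow> padic_abs y \<le> 1 \<longrightarrow>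
    padic_abs (poly f x - poly f y - poly (pderiv f) x * (x - y)) \<le> C * padic_abs (x - y) ^ 2"
proof (induction f)
  case 0
  show ?case by (auto intro!: exI[of _ 0])
next
  case (pCons a f)
  then obtain C where C: "C \<ge> 0" "\<And>x y. padic_abs x \<le> 1 \<Longrightarrow> padic_abs y \<le> 1 \<Longrightarrow>
      padic_abs (poly f x - poly f y - poly (pderiv f) x * (x - y)) \<le> C * padic_abs (x - y) ^ 2"
    by auto
  obtain B where B: "B \<ge> 0" "\<And>x. padic_abs x \<le> 1 \<Longrightarrow> padic_abs (poly (pderiv f) x) \<le> B"
    using poly_bounded_unit_ball by blast
  have "padic_abs (poly (pCons a f) x - poly (pCons a f) y - poly (pderiv (pCons a f)) x * (x - y))
      \<le> (C + B) * padic_abs (x - y) ^ 2" if x: "padic_abs x \<le> 1" and y: "padic_abs y \<le> 1" for x y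
  proof -
    let ?R = "poly f x - poly f y - poly (pderiv f) x * (x - y)"
    \<comment> \<open>Besides $y$ times the old remainder, only $-f'(x) (x - y)^2$ is left, and $f'$
      is bounded on the unit ball.\<close>
    have "poly (pCons a f) x - poly (pCons a f) y - poly (pderiv (pCons a f)) x * (x - y)
        = y * ?R + poly (pderiv f) x * ((y - x) * (x - y))"
      by (simp add: pderiv_pCons algebra_simps)
    then have "padic_abs (poly (pCons a f) x - poly (pCons a f) y
          - poly (pderiv (pCons a f)) x * (x - y))
        \<le> padic_abs y * padic_abs ?R + padic_abs (poly (pderiv f) x) * padic_abs (x - y) ^ 2"
      using abs_add_le[of "y * ?R" "poly (pderiv f) x * ((y - x) * (x - y))"]
      by (simp add: abs_mult abs_minus_commute[of y x] power2_eq_square)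
    also have "\<dots> \<le> 1 * (C * padic_abs (x - y) ^ 2) + B * padic_abs (x - y) ^ 2"
      using x y B C by (intro add_mono mult_mono) auto
    finally show ?thesis by (simp add: algebra_simps)
  qed
  then show ?case using B(1) C(1) by (intro exI[of _ "C + B"]) simp
qed

lemma poly_uniformly_differentiable:
  fixes f :: "'a poly"
  shows "uniformly_differentiable_on (poly f) padic_Z"
  unfolding uniformly_differentiable_on_def
proof (intro exI[of _ "poly (pderiv f)"] allI impI)
  fix e :: real
  assume e: "e > 0"
  obtain C where C: "C \<ge> 0" "\<And>x y. padic_abs x \<le> 1 \<Longrightarrow> padic_abs y \<le> 1 \<Longrightarrow>
      padic_abs (poly f x - poly f y - poly (pderiv f) x * (x - y)) \<le> C * padic_abs (x - y) ^ 2"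
    using poly_taylor_bound[of f] by blast
  \<comment> \<open>Dividing the Taylor bound by $|x - y|$ gives an error of at most $C |x - y|$.
    Using $C + 1$ in the radius covers $C = 0$.\<close>
  have "dist ((poly f x - poly f y) / (x - y)) (poly (pderiv f) x) < e"
    if x: "x \<in> padic_Z" and y: "y \<in> padic_Z" and xy: "x \<noteq> y" "dist x y < e / (C + 1)" for x y
  proof -
    let ?d = "padic_abs (x - y)" and ?q = "(poly f x - poly f y) / (x - y) - poly (pderiv f) x"
    have d: "?d > 0" using xy abs_pos by simp
    have "?q * (x - y) = poly f x - poly f y - poly (pderiv f) x * (x - y)"
      using xy by (simp add: field_simps)
    then have "padic_abs ?q * ?d \<le> C * ?d ^ 2"
      using C(2)[of x y] x y by (metis abs_mult padic_Z_def mem_Collect_eq)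
    then have "padic_abs ?q * ?d \<le> (C * ?d) * ?d"
      by (simp add: power2_eq_square mult.assoc)
    then have "padic_abs ?q \<le> C * ?d"
      using d by (simp only: mult_le_cancel_right_pos)
    also have "\<dots> < (C + 1) * ?d"
      using d by (simp add: algebra_simps)
    also have "\<dots> < e"
      using xy(2) C(1) by (simp add: dist_eq pos_less_divide_eq mult.commute)
    finally show ?thesis by (simp add: dist_eq)
  qed
  then show "\<exists>\<delta>>0. \<forall>x\<in>padic_Z. \<forall>y\<in>padic_Z. x \<noteq> y \<and> dist x y < \<delta> \<longrightarrow>
      dist ((poly f x - poly f y) / (x - y)) (poly (pderiv f) x) < e"
    using e C(1) by (intro exI[of _ "e / (C + 1)"]) auto
qed

lemma poly_power_tendsto:
  fixes f :: "'a poly" and a :: 'a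
  assumes "padic_abs a < 1"
  shows "(\<lambda>N. poly f (a ^ N)) \<longlonglongrightarrow> poly f 0"
proof (cases f)
  case (pCons c g)
  obtain B where B: "\<And>x. padic_abs x \<le> 1 \<Longrightarrow> padic_abs (poly g x) \<le> B"
    using poly_bounded_unit_ball by blast
  \<comment> \<open>Since $f = c + X g$, the difference is $a^N g(a^N)$, and $g$ is bounded on the
    unit ball.\<close>
  have "norm (dist (poly f (a ^ N)) (poly f 0)) \<le> padic_abs a ^ N * B" for N
    using assms B[of "a ^ N"]
    by (simp add: pCons dist_eq abs_mult abs_power power_le_one mult_left_mono)
  then have "\<forall>\<^sub>F N in sequentially. norm (dist (poly f (a ^ N)) (poly f 0)) \<le> padic_abs a ^ N * B"
    by simp
  moreover have "(\<lambda>N. padic_abs a ^ N * B) \<longlonglongrightarrow> 0"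
    using assms by (intro tendsto_mult_left_zero LIMSEQ_realpow_zero) auto
  ultimately have "(\<lambda>N. dist (poly f (a ^ N)) (poly f 0)) \<longlonglongrightarrow> 0"
    by (rule Lim_null_comparison)
  then show ?thesis by (rule iffD2[OF tendsto_dist_iff])
qed

end

section \<open>Specialization to $C_p$ and conclusion\<close>

lemma padic_complex_abs_valued_field:
  assumes "padic_complex p TYPE('a::{field_char_0, complete_space})"
  shows "abs_valued_field TYPE('a)"
proof
  fix x y :: 'a
  have "padic_abs (x + y) \<le> max (padic_abs x) (padic_abs y)"
    using assms by (simp add: padic_complex_def)
  then show "padic_abs (x + y) \<le> padic_abs x + padic_abs y"
    by (smt (verit) padic_abs_def zero_le_dist)
qed (use assms in \<open>simp_all add: padic_complex_def\<close>)

theorem theorem2p7: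
  fixes p n :: nat and lam x :: "'a::{field_char_0, complete_space}"
  assumes "prime p" and "odd p"
    and "padic_complex p TYPE('a)"
    and "lam \<noteq> 0"
  shows "has_bosonic_integral p (\<lambda>y. gen_ffact (x + y + 1/2) n lam)
           (degenerate_bernoulli_type2 lam n x) \<and>
         degenerate_bernoulli_type2 lam n x =
           (\<Sum>l=0..n. degenerate_stirling1 lam n l * bernoulli_type2 l x) \<and>
         degenerate_bernoulli_type2 lam n x =
           (\<Sum>m=0..n. of_nat (n choose m) * degenerate_bernoulli_type2 lam m 0
              * gen_ffact x (n - m) lam)"
proof (intro conjI)
  interpret abs_valued_field "TYPE('a)"
    using assms(3) by (rule padic_complex_abs_valued_field)
  \<comment> \<open>The integrand is a product of linear factors in $y$, hence a polynomial
    function.\<close>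
  have "poly (\<Prod>i<n. [:x + 1/2 - of_nat i * lam, 1:]) = (\<lambda>y. gen_ffact (x + y + 1/2) n lam)"
    by (simp add: fun_eq_iff poly_prod gen_ffact_def algebra_simps)
  then have "uniformly_differentiable_on (\<lambda>y. gen_ffact (x + y + 1/2) n lam) padic_Z"
    by (metis poly_uniformly_differentiable)
  \<comment> \<open>The nonzero factor $p^N$ cancels, which leaves the mean polynomial at
    $p^N$.\<close>
  moreover have "(\<lambda>N. (\<Sum>y<p ^ N. gen_ffact (x + of_nat y + 1/2) n lam) / of_nat p ^ N)
      = (\<lambda>N. poly (mean_poly lam n x) (of_nat p ^ N))"
    using \<open>prime p\<close> by (simp add: sum_gen_ffact_eq_mean_poly prime_gt_0_nat)
  moreover have "padic_abs (of_nat p :: 'a) < 1"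
    using assms(3) prime_gt_1_nat[OF \<open>prime p\<close>] by (simp add: padic_complex_def)
  ultimately show "has_bosonic_integral p (\<lambda>y. gen_ffact (x + y + 1/2) n lam)
      (degenerate_bernoulli_type2 lam n x)"
    by (simp add: has_bosonic_integral_def degenerate_bernoulli_eq_mean_poly[OF \<open>lam \<noteq> 0\<close>]
        poly_power_tendsto)
  show "degenerate_bernoulli_type2 lam n x =
      (\<Sum>l=0..n. degenerate_stirling1 lam n l * bernoulli_type2 l x)"
    by (simp add: degenerate_bernoulli_eq_mean_poly[OF \<open>lam \<noteq> 0\<close>] bernoulli_type2_eq_mean_poly
        mean_poly_eq_sum_stirling1[of lam] poly_sum atLeast0AtMost)
  show "degenerate_bernoulli_type2 lam n x =
      (\<Sum>m=0..n. of_nat (n choose m) * degenerate_bernoulli_type2 lam m 0 * gen_ffact x (n - m) lam)"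
    by (rule degenerate_bernoulli_eq_sum_binomial)
qed

end
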